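(* Let $(G,\mathcal{B},\mathcal{O})$ and $(H,\mathcal{C},\mathcal{P})$ be topological graphs which are homeomorphic (i.e. there is a graph homeomorphism between them). Then they have the same dimension spectrum: $\{\dim(B) : B\in\mathcal{B}\}=\{\dim(C) : C\in\mathcal{C}\}$.
   Context: All graphs are finite and simple. For a vertex $x$ of a graph $G=(V,E)$, the unit sphere $S(x)$ is the subgraph of $G$ generated (induced) by all vertices adjacent to $x$. The intersection of two subgraphs is the subgraph formed by their common vertices and common edges; a subgraph is also regarded as the set of its vertices when speaking of topologies on $V$. Dimension: $\dim(\emptyset)=-1$ and inductively $\dim(G)=\frac{1}{|V|}\sum_{x\in V}(1+\dim(S(x)))$. Homotopy: the one-point graph $K_1$ is contractible. A homotopy extension of a graph selects a contractible (induced) subgraph $H$ and adds a new vertex $z$ connected exactly to all vertices of $H$ (so $S(z)=H$). The reverse step removes a vertex $z$ with contractible unit sphere $S(z)$, together with all edges at $z$. Two graphs are homotopic if one can be obtained from the other by a finite sequence of such steps; a graph is contractible if it is homotopic to $K_1$. (This is an inductive definition.) Graph topology: two subgraphs $A,B$ satisfy the dimension assumption if $\dim(A\cap B)\ge \min(\dim(A),\dim(B))$, where the dimensions are those of these subgraphs as graphs themselves. A topology $\mathcal{O}$ on $V$ is a graph topology on $G=(V,E)$ if it has a sub-base $\mathcal{B}$ consisting of contractible subgraphs of $G$ such that (i) the intersection of any two elements of $\mathcal{B}$ satisfying the dimension assumption is contractible; (ii) every edge of $G$ is contained in some $B\in\mathcal{B}$; (iii) the nerve graph $\mathcal{G}=(\mathcal{B},\mathcal{E})$,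 whose vertices are the elements of $\mathcal{B}$ and whose edges are the pairs of distinct $A,B\in\mathcal{B}$ satisfying the dimension assumption, is homotopic to $G$. A graph with such a topology, written $(G,\mathcal{B},\mathcal{O})$, is a topological graph. The dimension spectrum is the image of the function $\dim$ on $\mathcal{B}$. Homeomorphism: given topological graphs $(G,\mathcal{B},\mathcal{O})$ and $(H,\mathcal{C},\mathcal{P})$ with nerve graphs $\mathcal{G},\mathcal{H}$, a map $\phi:\mathcal{O}\to\mathcal{P}$ is continuous if it induces a graph homomorphism $\mathcal{G}\to\mathcal{H}$ (it maps each $A\in\mathcal{B}$ to an element $\phi(A)\in\mathcal{C}$, edges of the nerve going to edges) such that $\dim(\phi(A))\le\dim(A)$ for every $A\in\mathcal{B}$. If $\phi$ has an inverse which is also continuous, $\phi$ is a graph homeomorphism. *)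

theory Defs
  imports "HOL-Analysis.Abstract_Topology"
begin

datatype 'a graph = Graph (verts: "'a set") (edges: "'a set set")

definition simple_graph :: "'a graph \<Rightarrow> bool" where
  "simple_graph G \<longleftrightarrow> finite (verts G) \<and> (\<forall>e\<in>edges G. e \<subseteq> verts G \<and> card e = 2)"

definition subgraph :: "'a graph \<Rightarrow> 'a graph \<Rightarrow> bool" where
  "subgraph A G \<longleftrightarrow> simple_graph A \<and> verts A \<subseteq> verts G \<and> edges A \<subseteq> edges G"

definition induced :: "'a graph \<Rightarrow> 'a set \<Rightarrow> 'a graph" where
  "induced G W = Graph (verts G \<inter> W) {e \<in> edges G. e \<subseteq> W}"

definition graph_inter :: "'a graph \<Rightarrow> 'a graph \<Rightarrow> 'a graph" where
  "graph_inter A B = Graph (verts A \<inter> verts B) (edges A \<inter> edges B)"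

definition unit_sphere :: "'a graph \<Rightarrow> 'a \<Rightarrow> 'a graph" where
  "unit_sphere G x = induced G {y. {x, y} \<in> edges G}"

definition graph_iso :: "'a graph \<Rightarrow> 'b graph \<Rightarrow> bool" where
  "graph_iso G H \<longleftrightarrow>
    (\<exists>f. bij_betw f (verts G) (verts H) \<and> edges H = (\<lambda>e. f ` e) ` edges G)"

definition graph_hom :: "'a graph \<Rightarrow> 'b graph \<Rightarrow> ('a \<Rightarrow> 'b) \<Rightarrow> bool" where
  "graph_hom G H f \<longleftrightarrow> f ` verts G \<subseteq> verts H \<and> (\<forall>e\<in>edges G. f ` e \<in> edges H)"

lemma card_unit_sphere_less:
  assumes "simple_graph G" "x \<in> verts G"
  shows "card (verts (unit_sphere G x)) < card (verts G)"
proof (rule psubset_card_mono)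
  show "finite (verts G)"
    using assms by (simp add: simple_graph_def)
  have "{x, x} \<notin> edges G"
    using assms by (auto simp: simple_graph_def)
  then have "x \<notin> verts (unit_sphere G x)"
    by (simp add: unit_sphere_def induced_def)
  moreover have "verts (unit_sphere G x) \<subseteq> verts G"
    by (simp add: unit_sphere_def induced_def)
  ultimately show "verts (unit_sphere G x) \<subset> verts G"
    using assms(2) by blast
qed

text \<open>The value \<open>-1\<close> outside finite simple graphs is a dummy; the guard is there for
  termination.\<close>

function graph_dim :: "'a graph \<Rightarrow> real" where
  "graph_dim G =
    (if simple_graph G \<and> verts G \<noteq> {}
     then (\<Sum>x\<in>verts G. 1 + graph_dim (unit_sphere G x)) / real (card (verts G))
     else -1)"
  by auto
termination
  by (relation "measure (\<lambda>G. card (verts G))") (auto intro: card_unit_sphere_less)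

declare graph_dim.simps [simp del]

definition homotopy_extension :: "'a graph \<Rightarrow> 'a set \<Rightarrow> 'a \<Rightarrow> 'a graph" where
  "homotopy_extension G W z = Graph (insert z (verts G)) (edges G \<union> (\<lambda>w. {z, w}) ` W)"

definition delete_vertex :: "'a graph \<Rightarrow> 'a \<Rightarrow> 'a graph" where
  "delete_vertex G z = induced G (verts G - {z})"

text \<open>A type \<open>'a\<close> may be too small to supply the new vertices of a homotopy extension, and a
  graph has to be compared with its nerve, whose vertices have another type. Homotopies are
  therefore carried out on graphs with vertices in \<open>nat\<close>, and transported to arbitrary types
  by isomorphism. In \<open>homotopy_steps\<close>, contractibility of a graph is being reachable
  from it of the one-point graph \<open>Graph {0} {}\<close>.\<close>

inductive homotopy_steps :: "nat graph \<Rightarrow> nat graph \<Rightarrow> bool" where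
  iso: "simple_graph G \<Longrightarrow> simple_graph H \<Longrightarrow> graph_iso G H \<Longrightarrow> homotopy_steps G H"
| extend: "homotopy_steps G H \<Longrightarrow> W \<subseteq> verts H \<Longrightarrow> homotopy_steps (induced H W) (Graph {0} {}) \<Longrightarrow>
    z \<notin> verts H \<Longrightarrow> homotopy_steps G (homotopy_extension H W z)"
| remove: "homotopy_steps G H \<Longrightarrow> z \<in> verts H \<Longrightarrow>
    homotopy_steps (unit_sphere H z) (Graph {0} {}) \<Longrightarrow> homotopy_steps G (delete_vertex H z)"

definition homotopic_graphs :: "'a graph \<Rightarrow> 'b graph \<Rightarrow> bool" where
  "homotopic_graphs G H \<longleftrightarrow>
    (\<exists>G' H'. graph_iso G G' \<and> graph_iso H H' \<and> homotopy_steps G' H')"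

definition contractible_graph :: "'a graph \<Rightarrow> bool" where
  "contractible_graph G \<longleftrightarrow> homotopic_graphs G (Graph {0::nat} {})"

definition dimension_assumption :: "'a graph \<Rightarrow> 'a graph \<Rightarrow> bool" where
  "dimension_assumption A B \<longleftrightarrow>
    graph_dim (graph_inter A B) \<ge> min (graph_dim A) (graph_dim B)"

definition nerve :: "'a graph set \<Rightarrow> 'a graph graph" where
  "nerve \<B> = Graph \<B>
    {{A, B} | A B. A \<in> \<B> \<and> B \<in> \<B> \<and> A \<noteq> B \<and> dimension_assumption A B}"

text \<open>Finite intersections in a sub-base include the empty one, which is \<open>V\<close>.\<close>

definition subbase_of :: "'a set set \<Rightarrow> 'a set \<Rightarrow> 'a topology \<Rightarrow> bool" where
  "subbase_of \<S> V \<O> \<longleftrightarrow> (\<forall>S\<in>\<S>. S \<subseteq> V) \<and>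
    openin \<O> = arbitrary union_of (finite intersection_of (\<lambda>S. S \<in> \<S>) relative_to V)"

definition topological_graph :: "'a graph \<Rightarrow> 'a graph set \<Rightarrow> 'a topology \<Rightarrow> bool" where
  "topological_graph G \<B> \<O> \<longleftrightarrow>
    simple_graph G \<and>
    topspace \<O> = verts G \<and>
    subbase_of (verts ` \<B>) (verts G) \<O> \<and>
    (\<forall>A\<in>\<B>. subgraph A G \<and> contractible_graph A) \<and>
    (\<forall>A\<in>\<B>. \<forall>B\<in>\<B>. dimension_assumption A B \<longrightarrow> contractible_graph (graph_inter A B)) \<and>
    (\<forall>e\<in>edges G. \<exists>B\<in>\<B>. e \<in> edges B) \<and>
    homotopic_graphs (nerve \<B>) G"

definition dim_spectrum :: "'a graph set \<Rightarrow> real set" where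
  "dim_spectrum \<B> = graph_dim ` \<B>"

text \<open>Open sets are sets of vertices, whereas the members of \<open>\<B>\<close> are subgraphs; they act as
  open sets through their vertex sets. So \<open>f\<close> is the map of nerve graphs induced by
  \<open>\<phi>\<close> if \<open>f A\<close> has vertex set \<open>\<phi> (verts A)\<close> for all \<open>A \<in> \<B>\<close>.\<close>

definition graph_continuous_via ::
  "'a graph set \<Rightarrow> 'a topology \<Rightarrow> 'b graph set \<Rightarrow> 'b topology \<Rightarrow>
    ('a set \<Rightarrow> 'b set) \<Rightarrow> ('a graph \<Rightarrow> 'b graph) \<Rightarrow> bool" where
  "graph_continuous_via \<B> \<O> \<C> \<P> \<phi> f \<longleftrightarrow>
    (\<forall>U. openin \<O> U \<longrightarrow> openin \<P> (\<phi> U)) \<and>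
    (\<forall>A\<in>\<B>. verts (f A) = \<phi> (verts A)) \<and>
    graph_hom (nerve \<B>) (nerve \<C>) f \<and>
    (\<forall>A\<in>\<B>. graph_dim (f A) \<le> graph_dim A)"

definition graph_continuous ::
  "'a graph set \<Rightarrow> 'a topology \<Rightarrow> 'b graph set \<Rightarrow> 'b topology \<Rightarrow> ('a set \<Rightarrow> 'b set) \<Rightarrow> bool" where
  "graph_continuous \<B> \<O> \<C> \<P> \<phi> \<longleftrightarrow> (\<exists>f. graph_continuous_via \<B> \<O> \<C> \<P> \<phi> f)"

text \<open>An inverse is required to invert \<open>\<phi>\<close> on the open sets as well as on the members of the
  sub-base. The latter is a condition only if distinct members of the sub-base share a vertex
  set; see \<open>graph_homeomorphism_iff\<close>.\<close>

definition graph_homeomorphism ::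
  "'a graph set \<Rightarrow> 'a topology \<Rightarrow> 'b graph set \<Rightarrow> 'b topology \<Rightarrow> ('a set \<Rightarrow> 'b set) \<Rightarrow> bool" where
  "graph_homeomorphism \<B> \<O> \<C> \<P> \<phi> \<longleftrightarrow>
    (\<exists>\<psi> f g.
      graph_continuous_via \<B> \<O> \<C> \<P> \<phi> f \<and> graph_continuous_via \<C> \<P> \<B> \<O> \<psi> g \<and>
      (\<forall>U. openin \<O> U \<longrightarrow> \<psi> (\<phi> U) = U) \<and> (\<forall>W. openin \<P> W \<longrightarrow> \<phi> (\<psi> W) = W) \<and>
      (\<forall>A\<in>\<B>. g (f A) = A) \<and> (\<forall>C\<in>\<C>. f (g C) = C))"

definition homeomorphic_graphs ::
  "'a graph set \<Rightarrow> 'a topology \<Rightarrow> 'b graph set \<Rightarrow> 'b topology \<Rightarrow> bool" where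
  "homeomorphic_graphs \<B> \<O> \<C> \<P> \<longleftrightarrow> (\<exists>\<phi>. graph_homeomorphism \<B> \<O> \<C> \<P> \<phi>)"

lemma openin_subbase_of:
  assumes "subbase_of \<S> V \<O>" "S \<in> \<S>"
  shows "openin \<O> S"
proof -
  have "(finite intersection_of (\<lambda>S. S \<in> \<S>)) S"
    using assms by (intro finite_intersection_of_inc)
  then have "(finite intersection_of (\<lambda>S. S \<in> \<S>) relative_to V) (V \<inter> S)"
    by (rule relative_to_inc)
  moreover have "V \<inter> S = S"
    using assms by (auto simp: subbase_of_def)
  ultimately show ?thesis
    using assms(1) by (simp add: subbase_of_def arbitrary_union_of_inc)
qed

lemma graph_homeomorphism_iff:
  fixes \<phi> :: "'a set \<Rightarrow> 'b set"
  assumes "topological_graph G \<B> \<O>" "topological_graph H \<C> \<P>"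
    and inj: "inj_on verts \<B>" "inj_on verts \<C>"
  shows "graph_homeomorphism \<B> \<O> \<C> \<P> \<phi> \<longleftrightarrow>
    graph_continuous \<B> \<O> \<C> \<P> \<phi> \<and>
    (\<exists>\<psi>. graph_continuous \<C> \<P> \<B> \<O> \<psi> \<and>
      (\<forall>U. openin \<O> U \<longrightarrow> \<psi> (\<phi> U) = U) \<and> (\<forall>W. openin \<P> W \<longrightarrow> \<phi> (\<psi> W) = W))"
    (is "?L \<longleftrightarrow> ?R")
proof
  assume ?L
  then obtain \<psi> f g where *: "graph_continuous_via \<B> \<O> \<C> \<P> \<phi> f"
    "graph_continuous_via \<C> \<P> \<B> \<O> \<psi> g"
    "\<forall>U. openin \<O> U \<longrightarrow> \<psi> (\<phi> U) = U" "\<forall>W. openin \<P> W \<longrightarrow> \<phi> (\<psi> W) = W"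
    unfolding graph_homeomorphism_def by (elim exE conjE) (rule that)
  show ?R
    unfolding graph_continuous_def
    by (intro conjI exI [of _ f] exI [of _ \<psi>] exI [of _ g]) (fact *)+
next
  assume ?R
  then obtain \<psi> f g where f: "graph_continuous_via \<B> \<O> \<C> \<P> \<phi> f"
    and g: "graph_continuous_via \<C> \<P> \<B> \<O> \<psi> g"
    and inv: "\<forall>U. openin \<O> U \<longrightarrow> \<psi> (\<phi> U) = U" "\<forall>W. openin \<P> W \<longrightarrow> \<phi> (\<psi> W) = W"
    unfolding graph_continuous_def by (elim exE conjE) (rule that)
  have mem: "\<And>A. A \<in> \<B> \<Longrightarrow> f A \<in> \<C>" "\<And>C. C \<in> \<C> \<Longrightarrow> g C \<in> \<B>"
    and vts: "\<And>A. A \<in> \<B> \<Longrightarrow> verts (f A) = \<phi> (verts A)"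
      "\<And>C. C \<in> \<C> \<Longrightarrow> verts (g C) = \<psi> (verts C)"
    using f g by (auto simp: graph_continuous_via_def graph_hom_def nerve_def)
  have opn: "\<And>A. A \<in> \<B> \<Longrightarrow> openin \<O> (verts A)" "\<And>C. C \<in> \<C> \<Longrightarrow> openin \<P> (verts C)"
    using assms(1,2) openin_subbase_of unfolding topological_graph_def by blast+
  have "g (f A) = A" if "A \<in> \<B>" for A
    by (rule inj_onD [OF inj(1)]) (simp_all add: that mem vts inv opn)
  moreover have "f (g C) = C" if "C \<in> \<C>" for C
    by (rule inj_onD [OF inj(2)]) (simp_all add: that mem vts inv opn)
  ultimately show ?L
    unfolding graph_homeomorphism_def
    by (intro exI [of _ \<psi>] exI [of _ f] exI [of _ g]) (simp add: f g inv)
qed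

end

theory Submission
  imports Defs
begin

text \<open>A continuous map never raises the dimension of a sub-base member. If the induced maps
  \<open>f\<close> and \<open>g\<close> on members are mutually inverse, then dim A = dim (g (f A))
  \<le> dim (f A) \<le> dim A, so \<open>f\<close> preserves dimension. Every dimension in \<B> thus
  occurs in \<C>, and conversely; \<open>dim_spectrum_subset\<close> carries the argument.\<close>

lemma graph_continuous_via_mem:
  "graph_continuous_via \<B> \<O> \<C> \<P> \<phi> f \<Longrightarrow> A \<in> \<B> \<Longrightarrow> f A \<in> \<C>"
  by (auto simp: graph_continuous_via_def graph_hom_def nerve_def)

lemma graph_continuous_via_dim_le:
  "graph_continuous_via \<B> \<O> \<C> \<P> \<phi> f \<Longrightarrow> A \<in> \<B> \<Longrightarrow> graph_dim (f A) \<le> graph_dim A"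
  by (simp add: graph_continuous_via_def)

text \<open>One inclusion needs only that \<open>g\<close> is a left inverse of \<open>f\<close> on
  members; exchanging the two sides gives the other inclusion.\<close>

lemma dim_spectrum_subset:
  assumes f: "graph_continuous_via \<B> \<O> \<C> \<P> \<phi> f"
    and g: "graph_continuous_via \<C> \<P> \<B> \<O> \<psi> g"
    and inv: "\<And>A. A \<in> \<B> \<Longrightarrow> g (f A) = A"
  shows "dim_spectrum \<B> \<subseteq> dim_spectrum \<C>"
  unfolding dim_spectrum_def
proof (rule image_subsetI)
  fix A assume A: "A \<in> \<B>"
  have fA: "f A \<in> \<C>"
    using f A by (rule graph_continuous_via_mem)
  have "graph_dim A = graph_dim (f A)"
    \<comment> \<open>The second bound is for \<open>g\<close> at \<open>f A\<close>; rewriting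
      \<open>g (f A)\<close> to \<open>A\<close> reverses the first bound.\<close>
    using graph_continuous_via_dim_le [OF f A] graph_continuous_via_dim_le [OF g fA]
    by (simp add: inv A)
  then show "graph_dim A \<in> graph_dim ` \<C>"
    using fA by (rule image_eqI)
qed

theorem theorem2:
  fixes G :: "'a graph" and \<B> :: "'a graph set" and \<O> :: "'a topology"
    and H :: "'b graph" and \<C> :: "'b graph set" and \<P> :: "'b topology"
  assumes "topological_graph G \<B> \<O>"
    and "topological_graph H \<C> \<P>"
    and "homeomorphic_graphs \<B> \<O> \<C> \<P>"
  shows "dim_spectrum \<B> = dim_spectrum \<C>"
proof -
  \<comment> \<open>Dimension depends on the edges of a member as well as on its vertices, so the
    inverse laws taken are those for \<open>f\<close> and \<open>g\<close> on members.\<close>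
  obtain \<phi> \<psi> f g where f: "graph_continuous_via \<B> \<O> \<C> \<P> \<phi> f"
    and g: "graph_continuous_via \<C> \<P> \<B> \<O> \<psi> g"
    and gf: "\<forall>A\<in>\<B>. g (f A) = A" and fg: "\<forall>C\<in>\<C>. f (g C) = C"
    using assms(3) unfolding homeomorphic_graphs_def graph_homeomorphism_def
    by (elim exE conjE) (rule that)
  show ?thesis
  proof
    show "dim_spectrum \<B> \<subseteq> dim_spectrum \<C>"
      using f g gf [rule_format] by (rule dim_spectrum_subset)
    show "dim_spectrum \<C> \<subseteq> dim_spectrum \<B>"
      using g f fg [rule_format] by (rule dim_spectrum_subset)
  qed
qed

end
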